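(* Let $G$ be a finite group such that any maximal subgroup of $G$ is an $IC\Phi$-subgroup of $G$. Then $G$ is nilpotent.
   Context: All groups are finite. For a group $G$ and a subgroup $H \le G$, $[H,G]$ denotes the subgroup generated by all commutators $[h,g]$ with $h \in H$, $g \in G$, and $\Phi(H)$ denotes the Frattini subgroup of $H$ (the intersection of all maximal subgroups of $H$, with $\Phi(1)=1$). A subgroup $H$ of $G$ is an $IC\Phi$-subgroup of $G$ if $H \cap [H,G] \le \Phi(H)$. *)

theory Defs
  imports "HOL-Algebra.Algebra"
begin

(* Commutators are [h, k] = h k h\<^sup>-1 k\<^sup>-1, as in derived_set. When H and K are subgroups,
   the convention h\<^sup>-1 k\<^sup>-1 h k yields the same generated subgroup. *)
definition commutator_subgroup :: "('a, 'b) monoid_scheme \<Rightarrow> 'a set \<Rightarrow> 'a set \<Rightarrow> 'a set" where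
  "commutator_subgroup G H K =
     generate G (\<Union>h\<in>H. \<Union>k\<in>K. {h \<otimes>\<^bsub>G\<^esub> k \<otimes>\<^bsub>G\<^esub> inv\<^bsub>G\<^esub> h \<otimes>\<^bsub>G\<^esub> inv\<^bsub>G\<^esub> k})"

lemma commutator_subgroup_self: "commutator_subgroup G H H = derived G H"
  by (simp add: commutator_subgroup_def derived_def)

definition maximal_subgroup :: "'a set \<Rightarrow> ('a, 'b) monoid_scheme \<Rightarrow> bool" where
  "maximal_subgroup M G \<longleftrightarrow> subgroup M G \<and> M \<noteq> carrier G \<and>
     (\<forall>K. subgroup K G \<longrightarrow> M \<subseteq> K \<longrightarrow> K = M \<or> K = carrier G)"

(* Intersecting with the carrier matters only if there are no maximal subgroups; for finite
   groups this is the trivial group, where it yields the convention \<Phi>(1) = 1. *)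
definition frattini :: "('a, 'b) monoid_scheme \<Rightarrow> 'a set" where
  "frattini G = carrier G \<inter> \<Inter>{M. maximal_subgroup M G}"

lemma frattini_trivial:
  assumes "carrier G = {\<one>\<^bsub>G\<^esub>}"
  shows "frattini G = {\<one>\<^bsub>G\<^esub>}"
proof -
  have "\<not> maximal_subgroup M G" for M
    using assms by (auto simp: maximal_subgroup_def subgroup_def)
  then show ?thesis
    using assms by (simp add: frattini_def)
qed

definition IC\<Phi>_subgroup :: "'a set \<Rightarrow> ('a, 'b) monoid_scheme \<Rightarrow> bool" where
  "IC\<Phi>_subgroup H G \<longleftrightarrow> subgroup H G \<and>
     H \<inter> commutator_subgroup G H (carrier G) \<subseteq> frattini (G\<lparr>carrier := H\<rparr>)"

primrec lower_central_series :: "('a, 'b) monoid_scheme \<Rightarrow> nat \<Rightarrow> 'a set" where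
  "lower_central_series G 0 = carrier G"
| "lower_central_series G (Suc n) =
     commutator_subgroup G (lower_central_series G n) (carrier G)"

definition nilpotent_group :: "('a, 'b) monoid_scheme \<Rightarrow> bool" where
  "nilpotent_group G \<longleftrightarrow> group G \<and> (\<exists>n. lower_central_series G n = {\<one>\<^bsub>G\<^esub>})"

end

theory Submission
  imports Defs
begin

text \<open>
  Let \<open>K\<close> be a maximal proper normal subgroup of \<open>G\<close>, let \<open>M \<supseteq> K\<close> be a maximal subgroup and put
  \<open>N = [M, G]\<close>, which is normal in \<open>G\<close>. If \<open>N K = G\<close>, then \<open>M = (M \<inter> N) K\<close> by Dedekind's law; as
  \<open>M \<inter> N \<subseteq> \<Phi>(M)\<close> consists of non-generators of \<open>M\<close>, this forces \<open>M = K\<close>. Otherwise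
  \<open>N \<subseteq> K \<subseteq> M\<close>. Either way \<open>M\<close> is normal, so \<open>T = [M, G] \<subseteq> \<Phi>(M)\<close>. Now \<open>M / T\<close> is central with
  cyclic quotient, so \<open>G / T\<close> is abelian. The same non-generator argument puts \<open>T\<close> into every maximal
  subgroup \<open>L\<close>; hence every maximal subgroup contains the derived subgroup and is normal. By the
  Frattini argument all Sylow subgroups are then normal, and the upper central series reaches \<open>G\<close>.
\<close>

subsection \<open>Actions of groups of prime power order\<close>

text \<open>Orbit lengths are powers of \<open>p\<close>; without a fixed point each would be
  divisible by \<open>p\<close>, and so would their sum \<open>card E\<close>. The action is a plain
  function \<open>f\<close>, so that conjugation and coset translation can be plugged in
  directly.\<close>

lemma (in group) p_group_fixed_point:
  assumes "Factorial_Ring.prime (p::nat)" and "order G = p ^ n"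
    and "finite E" and "\<not> p dvd card E"
    and closed: "\<And>g x. \<lbrakk>g \<in> carrier G; x \<in> E\<rbrakk> \<Longrightarrow> f g x \<in> E"
    and one: "\<And>x. x \<in> E \<Longrightarrow> f \<one> x = x"
    and mult: "\<And>g h x. \<lbrakk>g \<in> carrier G; h \<in> carrier G; x \<in> E\<rbrakk> \<Longrightarrow> f (g \<otimes> h) x = f g (f h x)"
  shows "\<exists>x\<in>E. \<forall>g\<in>carrier G. f g x = x"
proof (rule ccontr)
  assume no_fix: "\<not> ?thesis"
  \<comment> \<open>\<open>Bij E\<close> contains only maps that are undefined outside
    \<open>E\<close>, hence the restriction.\<close>
  define \<phi> where "\<phi> = (\<lambda>g. restrict (f g) E)"
  have bij: "\<phi> g \<in> Bij E" if g: "g \<in> carrier G" for g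
  proof -
    have "bij_betw (f g) E E"
    proof (rule bij_betw_byWitness[where f' = "f (inv g)"])
      show "\<forall>a\<in>E. f (inv g) (f g a) = a"
        using g mult[of "inv g" g] one by simp
      show "\<forall>a\<in>E. f g (f (inv g) a) = a"
        using g mult[of g "inv g"] one by simp
      show "f g ` E \<subseteq> E" "f (inv g) ` E \<subseteq> E"
        using g closed by auto
    qed
    then show ?thesis
      by (auto simp: Bij_def \<phi>_def cong: bij_betw_cong)
  qed
  have "\<phi> \<in> hom G (BijGroup E)"
  proof (rule homI)
    fix g h assume gh: "g \<in> carrier G" "h \<in> carrier G"
    have "\<phi> (g \<otimes> h) = compose E (\<phi> g) (\<phi> h)"
      using gh closed mult by (auto simp: \<phi>_def compose_def fun_eq_iff)
    then show "\<phi> (g \<otimes> h) = \<phi> g \<otimes>\<^bsub>BijGroup E\<^esub> \<phi> h"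
      using bij[OF gh(1)] bij[OF gh(2)] by (simp add: BijGroup_def)
  qed (simp add: BijGroup_def bij)
  then interpret act: group_action G E \<phi>
    by (simp add: group_action_def group_hom_def group_hom_axioms_def group_BijGroup)
  have dvd_orbit: "p dvd card orb" if "orb \<in> orbits G E \<phi>" for orb
  proof -
    from that obtain x where x: "x \<in> E" "orb = orbit G \<phi> x"
      by (auto simp: orbits_def)
    have "card orb dvd p ^ n"
      using act.orbit_stabilizer_theorem[OF x(1)] x(2) assms(2) by (metis dvd_triv_left)
    then obtain k where k: "card orb = p ^ k"
      using assms(1) by (metis divides_primepow_nat)
    \<comment> \<open>An orbit of length \<open>p ^ 0\<close> would consist of a fixed
      point.\<close>
    have "k \<noteq> 0"
    proof
      assume "k = 0"
      then obtain y where y: "orb = {y}"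
        using k by (auto simp: card_1_singleton_iff)
      then have "orb = {x}"
        using act.orbit_refl[OF x(1)] x(2) by auto
      then have "f g x = x" if "g \<in> carrier G" for g
        using that x by (auto simp: orbit_def \<phi>_def)
      then show False
        using no_fix x(1) by auto
    qed
    then show ?thesis
      using k by (simp add: dvd_power)
  qed
  have "card E = (\<Sum>orb\<in>orbits G E \<phi>. card orb)"
    using act.disjoint_sum[OF \<open>finite E\<close>, of "\<lambda>_. 1::nat"] by simp
  then have "p dvd card E"
    using dvd_orbit by (simp add: dvd_sum)
  then show False
    using assms(4) by blast
qed

lemma (in group) inj_on_conjugation:
  assumes "P \<subseteq> carrier G" and "g \<in> carrier G"
  shows "inj_on (\<lambda>x. g \<otimes> x \<otimes> inv g) P"
  using assms conjugation_is_inj by (meson inj_onI subsetD)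

text \<open>Conjugation acts on the non-identity elements. Their number is one less than a multiple
  of \<open>p\<close>, so some element is fixed, that is, central.\<close>

lemma (in group) p_group_center_nontrivial:
  assumes "Factorial_Ring.prime (p::nat)" and "order G = p ^ n" and "carrier G \<noteq> {\<one>}"
  shows "\<exists>z\<in>carrier G. z \<noteq> \<one> \<and> (\<forall>g\<in>carrier G. g \<otimes> z = z \<otimes> g)"
proof -
  have fin: "finite (carrier G)"
    using assms(1,2) order_gt_0_iff_finite by (simp add: prime_gt_0_nat)
  have "n \<noteq> 0"
    using assms(2,3) order_one_triv_iff by (metis power_0)
  then have "p dvd card (carrier G)"
    using assms(2) by (simp add: order_def dvd_power)
  moreover have "card (carrier G) = Suc (card (carrier G - {\<one>}))"
    using fin by (simp only: card_Suc_Diff1 one_closed)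
  ultimately have ndvd: "\<not> p dvd card (carrier G - {\<one>})"
    using assms(1) by (metis Suc_eq_plus1 dvd_add_right_iff not_prime_unit)
  have "\<exists>x\<in>carrier G - {\<one>}. \<forall>g\<in>carrier G. g \<otimes> x \<otimes> inv g = x"
  proof (rule p_group_fixed_point[OF assms(1,2) _ ndvd])
    fix g x assume gx: "g \<in> carrier G" "x \<in> carrier G - {\<one>}"
    then have "x = \<one>" if "g \<otimes> x \<otimes> inv g = \<one>"
      using that conjugation_is_inj[of g x \<one>] by simp
    then show "g \<otimes> x \<otimes> inv g \<in> carrier G - {\<one>}"
      using gx by auto
  qed (use fin in \<open>auto simp: inv_mult_group m_assoc\<close>)
  then obtain z where z: "z \<in> carrier G" "z \<noteq> \<one>"
    and fix_z: "\<And>g. g \<in> carrier G \<Longrightarrow> g \<otimes> z \<otimes> inv g = z"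
    by blast
  have "g \<otimes> z = z \<otimes> g" if "g \<in> carrier G" for g
    using fix_z[OF that] z that by (metis inv_solve_right m_closed)
  then show ?thesis
    using z by blast
qed

text \<open>The \<open>p\<close>-group \<open>P\<close> acts by translation on the right cosets of
  \<open>Q\<close>. Their number is prime to \<open>p\<close>, so some coset \<open>Q #> g\<close>
  is fixed, and this means that \<open>g\<close> conjugates \<open>P\<close> into
  \<open>Q\<close>.\<close>

lemma (in group) p_subgroup_conjugate_into:
  assumes "finite (carrier G)" and "Factorial_Ring.prime (p::nat)"
    and P: "subgroup P G" and "card P = p ^ n"
    and Q: "subgroup Q G" and "\<not> p dvd card (rcosets Q)"
  shows "\<exists>g\<in>carrier G. \<forall>x\<in>P. g \<otimes> x \<otimes> inv g \<in> Q"
proof -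
  interpret P: subgroup P G by fact
  interpret Q: subgroup Q G by fact
  interpret GP: group "G\<lparr>carrier := P\<rparr>"
    using P by (rule subgroup_imp_group)
  \<comment> \<open>Translating by \<open>inv h\<close> turns right multiplication into a left
    action.\<close>
  have "\<exists>C\<in>rcosets Q. \<forall>h\<in>carrier (G\<lparr>carrier := P\<rparr>). C #> inv h = C"
  proof (rule GP.p_group_fixed_point[OF assms(2), where n = n])
    show "finite (rcosets Q)"
      using assms(1) by (simp add: RCOSETS_def)
  next
    fix h C assume "h \<in> carrier (G\<lparr>carrier := P\<rparr>)" "C \<in> rcosets Q"
    then show "C #> inv h \<in> rcosets Q"
      by (auto simp: RCOSETS_def coset_mult_assoc Q.subset)
  next
    fix C assume "C \<in> rcosets Q"
    then show "C #> inv \<one>\<^bsub>G\<lparr>carrier := P\<rparr>\<^esub> = C"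
      using Q.rcosets_carrier[OF group_axioms] by simp
  next
    fix g h C
    assume "g \<in> carrier (G\<lparr>carrier := P\<rparr>)" "h \<in> carrier (G\<lparr>carrier := P\<rparr>)" "C \<in> rcosets Q"
    then show "C #> inv (g \<otimes>\<^bsub>G\<lparr>carrier := P\<rparr>\<^esub> h) = C #> inv h #> inv g"
      using Q.rcosets_carrier[OF group_axioms] by (simp add: inv_mult_group coset_mult_assoc)
  qed (use assms in \<open>auto simp: order_def\<close>)
  then obtain g where g: "g \<in> carrier G" and fix_coset: "\<And>h. h \<in> P \<Longrightarrow> Q #> g #> inv h = Q #> g"
    by (auto simp: RCOSETS_def)
  have "g \<otimes> x \<otimes> inv g \<in> Q" if "x \<in> P" for x
  proof -
    have "Q #> (g \<otimes> x) = Q #> g"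
      using fix_coset[of "inv x"] that g by (simp add: coset_mult_assoc Q.subset)
    then have "g \<otimes> x \<in> Q #> g"
      using that g Q by (metis P.mem_carrier m_closed rcos_self)
    then show ?thesis
      using that g Q.rcos_module_imp[OF group_axioms] by simp
  qed
  then show ?thesis
    using g by blast
qed

subsection \<open>Normal maximal subgroups and normal Sylow subgroups\<close>

lemma (in group) ex_maximal_subgroup_above:
  assumes "finite (carrier G)" and "subgroup H G" and "H \<noteq> carrier G"
  obtains M where "maximal_subgroup M G" and "H \<subseteq> M"
proof -
  define S where "S = {K. subgroup K G \<and> K \<noteq> carrier G \<and> H \<subseteq> K}"
  have "S \<subseteq> Pow (carrier G)"
    by (auto simp: S_def dest: subgroup.subset)
  then have "finite S"
    using assms(1) finite_subset by blast
  moreover have "H \<in> S"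
    using assms by (simp add: S_def)
  ultimately obtain M where M: "M \<in> S" and max: "\<And>K. K \<in> S \<Longrightarrow> M \<subseteq> K \<Longrightarrow> M = K"
    using finite_has_maximal2[of S H] by metis
  have "maximal_subgroup M G"
    unfolding maximal_subgroup_def
  proof (intro conjI allI impI)
    fix K assume K: "subgroup K G" "M \<subseteq> K"
    then have "K \<in> S" if "K \<noteq> carrier G"
      using M that by (auto simp: S_def)
    then show "K = M \<or> K = carrier G"
      using max K by blast
  qed (use M in \<open>auto simp: S_def\<close>)
  then show ?thesis
    using that M by (simp add: S_def)
qed

text \<open>An injective map of a finite set into itself is onto, so one inclusion suffices.\<close>

lemma (in group) conj_subset_imp_in_normalizer:
  assumes "finite P" and "P \<subseteq> carrier G" and g: "g \<in> carrier G"
    and conj: "\<And>x. x \<in> P \<Longrightarrow> g \<otimes> x \<otimes> inv g \<in> P"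
  shows "g \<in> normalizer G P"
proof -
  have eq: "g <# P #> inv g = (\<lambda>x. g \<otimes> x \<otimes> inv g) ` P"
    by (auto simp: l_coset_def r_coset_def)
  have "inj_on (\<lambda>x. g \<otimes> x \<otimes> inv g) P"
    using assms(2) g by (rule inj_on_conjugation)
  then have "(\<lambda>x. g \<otimes> x \<otimes> inv g) ` P = P"
    using conj assms(1) by (intro endo_inj_surj) auto
  then show ?thesis
    using eq assms(2) g by (simp add: normalizer_def stabilizer_def)
qed

lemma (in group) in_normalizerD:
  assumes "P \<subseteq> carrier G" and "g \<in> normalizer G P" and "x \<in> P"
  shows "g \<otimes> x \<otimes> inv g \<in> P"
proof -
  have "g <# P #> inv g = P"
    using assms(1,2) by (simp add: normalizer_def stabilizer_def)
  moreover have "g \<otimes> x \<otimes> inv g \<in> g <# P #> inv g"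
    using assms(3) by (auto simp: l_coset_def r_coset_def)
  ultimately show ?thesis by simp
qed

text \<open>A proper normalizer of \<open>P\<close> would lie in a maximal subgroup
  \<open>M\<close>, which is normal by hypothesis. The Frattini argument inside \<open>M\<close>
  then gives \<open>M = G\<close>, a contradiction.\<close>

lemma (in group) sylow_subgroup_normal:
  assumes fin: "finite (carrier G)"
    and max_normal: "\<And>M. maximal_subgroup M G \<Longrightarrow> M \<lhd> G"
    and p: "Factorial_Ring.prime (p::nat)"
    and P: "subgroup P G" "card P = p ^ n" and ord: "order G = p ^ n * m" "\<not> p dvd m"
  shows "P \<lhd> G"
proof -
  have PG: "P \<subseteq> carrier G" using P by (simp add: subgroup.subset)
  then have finP: "finite P" using fin finite_subset by blast
  let ?N = "normalizer G P"
  have N: "subgroup ?N G" using PG by (rule normalizer_imp_subgroup)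
  have "?N = carrier G"
  proof (rule ccontr)
    assume "?N \<noteq> carrier G"
    then obtain M where M: "maximal_subgroup M G" and NM: "?N \<subseteq> M"
      using ex_maximal_subgroup_above[OF fin N] by blast
    interpret M: normal M G using max_normal[OF M] .
    interpret GM: group "G\<lparr>carrier := M\<rparr>"
      using M.subgroup_axioms by (rule subgroup_imp_group)
    have "P \<subseteq> ?N"
    proof
      fix g assume "g \<in> P"
      then show "g \<in> ?N"
        using P(1) PG by (intro conj_subset_imp_in_normalizer[OF finP PG])
          (auto simp: subgroup.m_closed subgroup.m_inv_closed)
    qed
    then have PM: "P \<subseteq> M" using NM by blast
    have PsubM: "subgroup P (G\<lparr>carrier := M\<rparr>)"
      using P(1) M.subgroup_axioms PM by (rule subgroup_incl)
    \<comment> \<open>\<open>P\<close> is a Sylow subgroup of \<open>M\<close> as well, because its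
      index in \<open>M\<close> divides \<open>m\<close>.\<close>
    have ndvd: "\<not> p dvd card (rcosets\<^bsub>G\<lparr>carrier := M\<rparr>\<^esub> P)"
    proof
      assume dvd: "p dvd card (rcosets\<^bsub>G\<lparr>carrier := M\<rparr>\<^esub> P)"
      have "card (rcosets\<^bsub>G\<lparr>carrier := M\<rparr>\<^esub> P) * p ^ n = card M"
        using GM.lagrange[OF PsubM] P(2) by (simp add: order_def)
      moreover have "card M dvd p ^ n * m"
        using lagrange[OF M.subgroup_axioms] ord(1) by (metis dvd_triv_right)
      ultimately have "card (rcosets\<^bsub>G\<lparr>carrier := M\<rparr>\<^esub> P) dvd m"
        using p by (simp add: mult.commute[of _ "p ^ n"] prime_gt_0_nat flip: \<open>_ = card M\<close>)
      then show False
        using dvd ord(2) dvd_trans by blast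
    qed
    \<comment> \<open>Frattini argument\<close>
    have "carrier G \<subseteq> M"
    proof
      fix g assume g: "g \<in> carrier G"
      let ?P = "g <# P #> inv g"
      have eq: "?P = (\<lambda>x. g \<otimes> x \<otimes> inv g) ` P"
        by (auto simp: l_coset_def r_coset_def)
      have "inj_on (\<lambda>x. g \<otimes> x \<otimes> inv g) P"
        using PG g by (rule inj_on_conjugation)
      then have card: "card ?P = p ^ n"
        using eq P(2) by (simp add: card_image)
      have "?P \<subseteq> M"
        using eq PM g M.inv_op_closed2 by auto
      then have "subgroup ?P (G\<lparr>carrier := M\<rparr>)"
        using subgroup_conjugation_is_surj2[OF g P(1)] M.subgroup_axioms by (intro subgroup_incl)
      moreover have "finite (carrier (G\<lparr>carrier := M\<rparr>))"
        using fin M.subset finite_subset by auto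
      ultimately obtain h where h: "h \<in> M"
        and conj: "\<And>x. x \<in> ?P \<Longrightarrow> h \<otimes> x \<otimes> inv\<^bsub>G\<lparr>carrier := M\<rparr>\<^esub> h \<in> P"
        using GM.p_subgroup_conjugate_into[OF _ p _ card PsubM ndvd] by auto
      \<comment> \<open>Conjugation by \<open>g\<close> takes \<open>P\<close> to \<open>?P\<close>,
        and conjugation by \<open>h\<close> brings \<open>?P\<close> back into
        \<open>P\<close>.\<close>
      have "h \<otimes> g \<in> ?N"
      proof (rule conj_subset_imp_in_normalizer[OF finP PG])
        fix x assume x: "x \<in> P"
        have "h \<otimes> (g \<otimes> x \<otimes> inv g) \<otimes> inv h \<in> P"
          using conj[of "g \<otimes> x \<otimes> inv g"] x h eq M.subgroup_axioms by (simp add: m_inv_consistent)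
        then show "h \<otimes> g \<otimes> x \<otimes> inv (h \<otimes> g) \<in> P"
          using x PG h g by (simp add: m_assoc inv_mult_group subsetD)
      qed (use h g in simp)
      then have "inv h \<otimes> (h \<otimes> g) \<in> M"
        using NM h by blast
      then show "g \<in> M"
        using h g by (simp add: m_assoc[symmetric])
    qed
    then show False
      using M M.subset by (auto simp: maximal_subgroup_def)
  qed
  then show ?thesis
    using P(1) PG by (intro normal_invI in_normalizerD) auto
qed


subsection \<open>Commutators modulo a normal subgroup\<close>

text \<open>For normal \<open>Z\<close> this is the preimage of the centralizer of \<open>S Z / Z\<close> in \<open>G / Z\<close>; it replaces
  computations in the quotient group.\<close>

definition centralizer_modulo :: "('a, 'b) monoid_scheme \<Rightarrow> 'a set \<Rightarrow> 'a set \<Rightarrow> 'a set" where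
  "centralizer_modulo G Z S =
     {g \<in> carrier G. \<forall>x\<in>S. g \<otimes>\<^bsub>G\<^esub> x \<otimes>\<^bsub>G\<^esub> inv\<^bsub>G\<^esub> g \<otimes>\<^bsub>G\<^esub> inv\<^bsub>G\<^esub> x \<in> Z}"

lemma (in group) inv_mult_cancel:
  assumes "x \<in> carrier G" and "y \<in> carrier G"
  shows "x \<otimes> (inv x \<otimes> y) = y" and "inv x \<otimes> (x \<otimes> y) = y"
  using assms by (simp_all flip: m_assoc)

lemma (in group) commutator_swap:
  assumes "Z \<lhd> G" and "x \<in> carrier G" and "y \<in> carrier G"
    and "x \<otimes> y \<otimes> inv x \<otimes> inv y \<in> Z"
  shows "y \<otimes> x \<otimes> inv y \<otimes> inv x \<in> Z"
proof -
  have "inv (x \<otimes> y \<otimes> inv x \<otimes> inv y) = y \<otimes> x \<otimes> inv y \<otimes> inv x"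
    using assms by (simp add: inv_mult_group m_assoc)
  then show ?thesis
    using assms(1,4) by (metis normal_imp_subgroup subgroup.m_inv_closed)
qed

text \<open>Closure follows from the identities \<open>[inv g, x] = inv g [g, x]^(-1) g\<close> and
  \<open>[g h, x] = (g [h, x] inv g) [g, x]\<close>, since \<open>Z\<close> is normal.\<close>

lemma (in group) centralizer_modulo_subgroup:
  assumes "Z \<lhd> G" and S: "S \<subseteq> carrier G"
  shows "subgroup (centralizer_modulo G Z S) G"
proof -
  interpret Z: normal Z G by fact
  show ?thesis
  proof (rule subgroupI)
    have "\<one> \<in> centralizer_modulo G Z S"
      using S by (auto simp: centralizer_modulo_def)
    then show "centralizer_modulo G Z S \<noteq> {}" by blast
  next
    fix g assume g: "g \<in> centralizer_modulo G Z S"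
    then have gG: "g \<in> carrier G" by (simp add: centralizer_modulo_def)
    have "inv g \<otimes> x \<otimes> inv (inv g) \<otimes> inv x \<in> Z" if "x \<in> S" for x
    proof -
      have xG: "x \<in> carrier G" using that S by blast
      have "inv g \<otimes> inv (g \<otimes> x \<otimes> inv g \<otimes> inv x) \<otimes> g \<in> Z"
        using g that gG by (intro Z.inv_op_closed1 Z.m_inv_closed) (auto simp: centralizer_modulo_def)
      then show ?thesis
        using gG xG by (simp add: inv_mult_group m_assoc inv_mult_cancel)
    qed
    then show "inv g \<in> centralizer_modulo G Z S"
      using gG by (simp add: centralizer_modulo_def)
  next
    fix g h assume gh: "g \<in> centralizer_modulo G Z S" "h \<in> centralizer_modulo G Z S"
    then have ghG: "g \<in> carrier G" "h \<in> carrier G" by (simp_all add: centralizer_modulo_def)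
    have "g \<otimes> h \<otimes> x \<otimes> inv (g \<otimes> h) \<otimes> inv x \<in> Z" if "x \<in> S" for x
    proof -
      have xG: "x \<in> carrier G" using that S by blast
      have "h \<otimes> x \<otimes> inv h \<otimes> inv x \<in> Z" "g \<otimes> x \<otimes> inv g \<otimes> inv x \<in> Z"
        using gh that by (simp_all add: centralizer_modulo_def)
      then have "g \<otimes> (h \<otimes> x \<otimes> inv h \<otimes> inv x) \<otimes> inv g \<otimes> (g \<otimes> x \<otimes> inv g \<otimes> inv x) \<in> Z"
        using Z.m_closed[OF Z.inv_op_closed2[OF ghG(1)]] by blast
      then show ?thesis
        using ghG xG by (simp add: inv_mult_group m_assoc inv_mult_cancel)
    qed
    then show "g \<otimes> h \<in> centralizer_modulo G Z S"
      using ghG by (simp add: centralizer_modulo_def)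
  qed (auto simp: centralizer_modulo_def)
qed

text \<open>Write \<open>[z, x]\<close> as the product of \<open>z\<close> and a conjugate of
  \<open>inv z\<close>.\<close>

lemma (in group) normal_subset_centralizer_modulo:
  assumes "Z \<lhd> G" and "S \<subseteq> carrier G"
  shows "Z \<subseteq> centralizer_modulo G Z S"
proof
  interpret Z: normal Z G by fact
  fix z assume z: "z \<in> Z"
  have "z \<otimes> x \<otimes> inv z \<otimes> inv x \<in> Z" if "x \<in> S" for x
  proof -
    have xG: "x \<in> carrier G" using that assms(2) by (rule subsetD[rotated])
    have "z \<otimes> (x \<otimes> inv z \<otimes> inv x) \<in> Z"
      by (rule Z.m_closed[OF z Z.inv_op_closed2[OF xG Z.m_inv_closed[OF z]]])
    then show ?thesis
      using z xG by (simp add: m_assoc)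
  qed
  then show "z \<in> centralizer_modulo G Z S"
    using z by (simp add: centralizer_modulo_def)
qed

text \<open>This is the preimage of the center of \<open>G / Z\<close>. It contains
  \<open>Z\<close>, hence \<open>[g, x]\<close>, and therefore also \<open>[g, x] x\<close>, which
  is the conjugate of \<open>x\<close> by \<open>g\<close>.\<close>

lemma (in group) centralizer_modulo_carrier_normal:
  assumes "Z \<lhd> G"
  shows "centralizer_modulo G Z (carrier G) \<lhd> G"
proof (rule normal_invI)
  let ?C = "centralizer_modulo G Z (carrier G)"
  show C: "subgroup ?C G"
    using assms by (rule centralizer_modulo_subgroup) simp
  fix g x assume g: "g \<in> carrier G" and x: "x \<in> ?C"
  then have xG: "x \<in> carrier G" by (simp add: centralizer_modulo_def)
  have "x \<otimes> g \<otimes> inv x \<otimes> inv g \<in> Z"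
    using x g by (simp add: centralizer_modulo_def)
  then have "g \<otimes> x \<otimes> inv g \<otimes> inv x \<in> ?C"
    using commutator_swap[OF assms xG g] normal_subset_centralizer_modulo[OF assms subset_refl] by blast
  then have "g \<otimes> x \<otimes> inv g \<otimes> inv x \<otimes> x \<in> ?C"
    using x C by (simp add: subgroup.m_closed)
  then show "g \<otimes> x \<otimes> inv g \<in> ?C"
    using g xG by (simp add: m_assoc)
qed

section \<open>Commutator subgroups and their normality\<close>

lemma commutator_subgroup_incl:
  "\<lbrakk>h \<in> H; k \<in> K\<rbrakk> \<Longrightarrow> h \<otimes>\<^bsub>G\<^esub> k \<otimes>\<^bsub>G\<^esub> inv\<^bsub>G\<^esub> h \<otimes>\<^bsub>G\<^esub> inv\<^bsub>G\<^esub> k \<in> commutator_subgroup G H K"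
  unfolding commutator_subgroup_def by (blast intro: generate.incl)

lemma (in group) commutator_subgroup_le:
  assumes "Z \<lhd> G" and "H \<subseteq> centralizer_modulo G Z K"
  shows "commutator_subgroup G H K \<subseteq> Z"
  unfolding commutator_subgroup_def
  using assms by (intro generate_subgroup_incl)
    (auto simp: centralizer_modulo_def normal_imp_subgroup)

lemma (in group) commutator_subgroup_mono:
  assumes "H \<subseteq> H'"
  shows "commutator_subgroup G H K \<subseteq> commutator_subgroup G H' K"
  unfolding commutator_subgroup_def using assms by (intro mono_generate) blast

text \<open>Conjugates of generators are products of generators and their inverses, because the
  second entry ranges over all of \<open>G\<close>. Induction over \<open>generate\<close> extends
  this to the whole subgroup.\<close>

lemma (in group) commutator_subgroup_normal:
  assumes H: "H \<subseteq> carrier G"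
  shows "commutator_subgroup G H (carrier G) \<lhd> G"
proof -
  let ?S = "\<Union>h\<in>H. \<Union>k\<in>carrier G. {h \<otimes> k \<otimes> inv h \<otimes> inv k}"
  let ?N = "commutator_subgroup G H (carrier G)"
  have S: "?S \<subseteq> carrier G" using H by auto
  have N: "subgroup ?N G"
    unfolding commutator_subgroup_def using S by (rule generate_is_subgroup)
  interpret N: subgroup ?N G by (rule N)
  have gen: "g \<otimes> s \<otimes> inv g \<in> ?N" if s: "s \<in> ?S" and g: "g \<in> carrier G" for s g
  proof -
    from s obtain h k where hk: "h \<in> H" "k \<in> carrier G" "s = h \<otimes> k \<otimes> inv h \<otimes> inv k" by blast
    have hG: "h \<in> carrier G" using hk H by blast
    \<comment> \<open>\<open>[h, g k] = [h, g] (g [h, k] g\<inverse>)\<close>\<close>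
    have "inv (h \<otimes> g \<otimes> inv h \<otimes> inv g) \<otimes> (h \<otimes> (g \<otimes> k) \<otimes> inv h \<otimes> inv (g \<otimes> k)) \<in> ?N"
      by (rule N.m_closed[OF N.m_inv_closed[OF commutator_subgroup_incl] commutator_subgroup_incl])
        (use hk g in auto)
    then show ?thesis
      using hk(2,3) hG g by (simp add: inv_mult_group m_assoc inv_mult_cancel)
  qed
  show ?thesis
  proof (rule normal_invI[OF N])
    fix g n assume g: "g \<in> carrier G" and "n \<in> ?N"
    then have "n \<in> generate G ?S" by (simp add: commutator_subgroup_def)
    then show "g \<otimes> n \<otimes> inv g \<in> ?N"
    proof (induction rule: generate.induct)
      case one
      then show ?case using g by simp
    next
      case (incl s)
      then show ?case using gen g by blast
    next
      case (inv s)
      then have "s \<in> carrier G" using S by blast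
      moreover have "inv (g \<otimes> s \<otimes> inv g) \<in> ?N"
        using inv gen g by blast
      ultimately show ?case
        using g by (simp add: inv_mult_group m_assoc)
    next
      case (eng s t)
      then have st: "s \<in> carrier G" "t \<in> carrier G"
        using generate_in_carrier[OF S] by blast+
      have "(g \<otimes> s \<otimes> inv g) \<otimes> (g \<otimes> t \<otimes> inv g) \<in> ?N"
        using eng.IH by (rule N.m_closed)
      then show ?case
        using g st by (simp add: m_assoc inv_mult_cancel)
    qed
  qed
qed

subsection \<open>Nilpotency from normality of the maximal subgroups\<close>

lemma (in group) subgroup_card_dvd:
  assumes "subgroup H G" and "subgroup K G" and "H \<subseteq> K"
  shows "card H dvd card K"
proof -
  have "card (rcosets\<^bsub>G\<lparr>carrier := K\<rparr>\<^esub> H) * card H = card K"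
    using group.lagrange[OF subgroup_imp_group[OF assms(2)] subgroup_incl[OF assms]]
    by (simp add: order_def)
  then show ?thesis
    by (metis dvd_triv_right)
qed

text \<open>The exponent is the multiplicity of \<open>p\<close> in the group order. It may be 0, so
  primes not dividing the order are covered, with trivial \<open>P\<close>.\<close>

lemma (in group) obtain_sylow_subgroup:
  assumes "finite (carrier G)" and "Factorial_Ring.prime (p::nat)"
  obtains P n m where "subgroup P G" and "card P = p ^ n" and "order G = p ^ n * m" and "\<not> p dvd m"
proof -
  have "order G \<noteq> 0" "\<not> is_unit p"
    using assms order_gt_0_iff_finite by auto
  then obtain m where m: "order G = p ^ multiplicity p (order G) * m" "\<not> p dvd m"
    by (rule multiplicity_decompose')
  then show thesis
    using sylow_thm[OF assms(2) group_axioms m(1) assms(1)] that by blast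
qed

text \<open>\<open>G Mod N\<close> is a nontrivial \<open>p\<close>-group; \<open>x\<close>
  represents a nontrivial element of its center.\<close>

lemma (in group) p_group_central_modulo:
  assumes "Factorial_Ring.prime (p::nat)" and "order G = p ^ n"
    and "N \<lhd> G" and "N \<noteq> carrier G"
  obtains x where "x \<in> carrier G" and "x \<notin> N"
    and "\<And>g. g \<in> carrier G \<Longrightarrow> g \<otimes> x \<otimes> inv g \<otimes> inv x \<in> N"
proof -
  interpret N: normal N G by fact
  interpret Q: group "G Mod N" by (rule N.factorgroup_is_group)
  have "order (G Mod N) dvd p ^ n"
    using lagrange[OF N.subgroup_axioms] assms(2)
    by (metis FactGroup_def dvd_triv_left order_def partial_object.select_convs(1))
  then obtain k where k: "order (G Mod N) = p ^ k"
    using assms(1) by (metis divides_primepow_nat)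
  have "carrier (G Mod N) \<noteq> {\<one>\<^bsub>G Mod N\<^esub>}"
  proof
    assume "carrier (G Mod N) = {\<one>\<^bsub>G Mod N\<^esub>}"
    then have "N #> x = N" if "x \<in> carrier G" for x
      using that by (auto simp: carrier_FactGroup)
    then have "carrier G \<subseteq> N"
      using coset_join1 N.subgroup_axioms by blast
    then show False
      using assms(4) N.subset by blast
  qed
  then obtain z where "z \<in> carrier (G Mod N)" and zN: "z \<noteq> N"
    and comm: "\<And>C. C \<in> carrier (G Mod N) \<Longrightarrow> C <#> z = z <#> C"
    using Q.p_group_center_nontrivial[OF assms(1) k] by auto
  then obtain x where x: "x \<in> carrier G" "z = N #> x"
    by (auto simp: carrier_FactGroup)
  have "g \<otimes> x \<otimes> inv g \<otimes> inv x \<in> N" if g: "g \<in> carrier G" for g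
  proof -
    have "N #> (g \<otimes> x) = N #> (x \<otimes> g)"
      using comm[of "N #> g"] g x by (auto simp: carrier_FactGroup N.rcos_sum)
    then have "g \<otimes> x \<in> N #> (x \<otimes> g)"
      using g x(1) N.subgroup_axioms by (metis m_closed rcos_self)
    then have "g \<otimes> x \<otimes> inv (x \<otimes> g) \<in> N"
      using g x(1) by (intro N.rcos_module_imp[OF group_axioms]) auto
    then show ?thesis
      using g x(1) by (simp add: inv_mult_group m_assoc)
  qed
  moreover have "x \<notin> N"
    using zN x coset_join2 N.subgroup_axioms by blast
  ultimately show thesis
    using that x(1) by blast
qed

text \<open>Bracket the commutator in two ways: as a conjugate of \<open>x\<close> times
  \<open>inv x\<close>, and as \<open>y\<close> times a conjugate of \<open>inv y\<close>.\<close>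

lemma (in group) normal_commutator_in_Int:
  assumes "P \<lhd> G" and "Q \<lhd> G" and "x \<in> P" and "y \<in> Q"
  shows "y \<otimes> x \<otimes> inv y \<otimes> inv x \<in> P \<inter> Q"
proof -
  interpret P: normal P G by fact
  interpret Q: normal Q G by fact
  have "y \<otimes> x \<otimes> inv y \<otimes> inv x \<in> P"
    by (rule P.m_closed[OF P.inv_op_closed2]) (use assms in auto)
  moreover have "y \<otimes> (x \<otimes> inv y \<otimes> inv x) \<in> Q"
    by (rule Q.m_closed[OF _ Q.inv_op_closed2]) (use assms in auto)
  ultimately show ?thesis
    using assms by (simp add: m_assoc)
qed

text \<open>By Lagrange the order of the intersection divides two coprime numbers.\<close>

lemma (in group) prime_power_subgroups_Int:
  assumes "Factorial_Ring.prime (p::nat)" and "Factorial_Ring.prime q" and "p \<noteq> q"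
    and "subgroup P G" and "card P = p ^ n" and "subgroup Q G" and "card Q = q ^ m"
  shows "P \<inter> Q = {\<one>}"
proof -
  have I: "subgroup (P \<inter> Q) G"
    using assms by (intro subgroups_Inter_pair)
  have "card (P \<inter> Q) dvd p ^ n" "card (P \<inter> Q) dvd q ^ m"
    using subgroup_card_dvd[OF I] assms by (metis inf_le1, metis inf_le2)
  moreover have "coprime (p ^ n) (q ^ m)"
    using assms(1-3) by (simp add: primes_coprime)
  ultimately have "card (P \<inter> Q) = 1"
    by (metis coprime_common_divisor nat_dvd_1_iff_1)
  then show ?thesis
    using subgroup.one_closed[OF I] by (metis card_1_singletonE singletonD)
qed

text \<open>This makes the center of \<open>G / Z\<close> nontrivial. For a prime \<open>p\<close>
  dividing the index of \<open>Z\<close>, the Sylow subgroup \<open>P\<close> is not inside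
  \<open>Z\<close>, and \<open>x\<close> is chosen central in \<open>P\<close> modulo
  \<open>P \<inter> Z\<close>. Sylow subgroups for other primes commute with \<open>P\<close>, both
  being normal with trivial intersection.\<close>

lemma (in group) ex_central_modulo:
  assumes fin: "finite (carrier G)"
    and max_normal: "\<And>M. maximal_subgroup M G \<Longrightarrow> M \<lhd> G"
    and Z: "Z \<lhd> G" "Z \<noteq> carrier G"
  shows "\<exists>x\<in>centralizer_modulo G Z (carrier G). x \<notin> Z"
proof -
  interpret Z: normal Z G by (rule Z)
  have index: "card (rcosets Z) * card Z = order G"
    using lagrange[OF Z.subgroup_axioms] .
  have "card (rcosets Z) \<noteq> 1"
  proof
    assume "card (rcosets Z) = 1"
    then have "card Z = card (carrier G)"
      using index by (simp add: order_def)
    then show False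
      using Z.subset Z(2) fin by (metis card_subset_eq)
  qed
  then obtain p where p: "Factorial_Ring.prime p" "p dvd card (rcosets Z)"
    using prime_factor_nat by blast
  obtain P n m where P: "subgroup P G" "card P = p ^ n" and ord: "order G = p ^ n * m" "\<not> p dvd m"
    using obtain_sylow_subgroup[OF fin p(1)] .
  have P_normal: "P \<lhd> G"
    using sylow_subgroup_normal[OF fin max_normal p(1) P ord] .
  have "\<not> P \<subseteq> Z"
  proof
    assume "P \<subseteq> Z"
    then have "p ^ n dvd card Z"
      using subgroup_card_dvd[OF P(1) Z.subgroup_axioms] P(2) by simp
    \<comment> \<open>\<open>p\<close> divides the index of \<open>Z\<close> and
      \<open>p ^ n\<close> its order, so their product divides \<open>order G\<close>.\<close>
    then have "p * p ^ n dvd p ^ n * m"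
      using p(2) index ord(1) by (metis mult_dvd_mono)
    then have "p dvd m"
      using p(1) by (simp add: mult.commute[of p] prime_gt_0_nat)
    then show False
      using ord(2) by blast
  qed
  interpret GP: group "G\<lparr>carrier := P\<rparr>"
    using P(1) by (rule subgroup_imp_group)
  have "P \<inter> Z \<lhd> G\<lparr>carrier := P\<rparr>"
    using second_isomorphism_grp.normal_subgrp_intersection_normal[of Z G P] Z(1) P(1)
    by (simp add: second_isomorphism_grp_def second_isomorphism_grp_axioms_def)
  moreover have "P \<inter> Z \<noteq> carrier (G\<lparr>carrier := P\<rparr>)"
    using \<open>\<not> P \<subseteq> Z\<close> by auto
  moreover have "order (G\<lparr>carrier := P\<rparr>) = p ^ n"
    using P(2) by (simp add: order_def)
  ultimately obtain x where "x \<in> carrier (G\<lparr>carrier := P\<rparr>)" "x \<notin> P \<inter> Z"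
    and "\<And>g. g \<in> carrier (G\<lparr>carrier := P\<rparr>) \<Longrightarrow>
      g \<otimes>\<^bsub>G\<lparr>carrier := P\<rparr>\<^esub> x \<otimes>\<^bsub>G\<lparr>carrier := P\<rparr>\<^esub> inv\<^bsub>G\<lparr>carrier := P\<rparr>\<^esub> g
        \<otimes>\<^bsub>G\<lparr>carrier := P\<rparr>\<^esub> inv\<^bsub>G\<lparr>carrier := P\<rparr>\<^esub> x \<in> P \<inter> Z"
    using GP.p_group_central_modulo[OF p(1)] by metis
  then have x: "x \<in> P" "x \<notin> Z" and comm: "\<And>g. g \<in> P \<Longrightarrow> g \<otimes> x \<otimes> inv g \<otimes> inv x \<in> Z"
    using P(1) by (auto simp: m_inv_consistent)
  have xG: "x \<in> carrier G"
    using x(1) P(1) by (simp add: subgroup.mem_carrier)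
  \<comment> \<open>\<open>?C\<close> contains a Sylow subgroup for every prime: \<open>P\<close> by the choice of \<open>x\<close>, and the others because
    they commute with \<open>P\<close>. Hence it is the whole group.\<close>
  let ?C = "centralizer_modulo G Z {x}"
  have C: "subgroup ?C G"
    using Z(1) xG by (intro centralizer_modulo_subgroup) auto
  have "order G dvd card ?C"
  proof (rule multiplicity_le_imp_dvd)
    show "order G \<noteq> 0"
      using fin order_gt_0_iff_finite by simp
    fix q :: nat assume q: "Factorial_Ring.prime q"
    obtain Q a b where Q: "subgroup Q G" "card Q = q ^ a" and ordq: "order G = q ^ a * b" "\<not> q dvd b"
      using obtain_sylow_subgroup[OF fin q] .
    have Q_normal: "Q \<lhd> G"
      using sylow_subgroup_normal[OF fin max_normal q Q ordq] .
    have mult: "multiplicity q (order G) = a"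
      using multiplicity_decomposeI[OF ordq] q by auto
    have "\<exists>R. subgroup R G \<and> card R = q ^ a \<and> R \<subseteq> ?C"
    proof (cases "q = p")
      case True
      have "n = a"
        using mult multiplicity_decomposeI[OF ord] p(1) True by auto
      moreover have "P \<subseteq> ?C"
        using comm subgroup.subset[OF P(1)] by (auto simp: centralizer_modulo_def)
      ultimately show ?thesis
        using P True by blast
    next
      case False
      have "P \<inter> Q = {\<one>}"
        using prime_power_subgroups_Int[OF p(1) q _ P Q] False by blast
      then have "Q \<subseteq> ?C"
        using normal_commutator_in_Int[OF P_normal Q_normal x(1)] subgroup.subset[OF Q(1)]
        by (auto simp: centralizer_modulo_def)
      then show ?thesis
        using Q by blast
    qed
    then have "q ^ a dvd card ?C"
      using subgroup_card_dvd[OF _ C] by metis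
    moreover have "card ?C \<noteq> 0"
      using subgroup.finite_imp_card_positive[OF C fin] by simp
    ultimately show "multiplicity q (order G) \<le> multiplicity q (card ?C)"
      using mult q by (auto intro!: multiplicity_geI)
  qed
  moreover have "card ?C dvd order G"
    using subgroup_card_dvd[OF C subgroup_self subgroup.subset[OF C]] by (simp add: order_def)
  ultimately have "card ?C = card (carrier G)"
    by (simp add: order_def dvd_antisym)
  then have "?C = carrier G"
    using card_subset_eq[OF fin subgroup.subset[OF C]] by blast
  then have "g \<otimes> x \<otimes> inv g \<otimes> inv x \<in> Z" if "g \<in> carrier G" for g
    using that by (auto simp: centralizer_modulo_def)
  \<comment> \<open>So far \<open>x\<close> is the second entry of the commutators; membership
    requires it as the first.\<close>
  then have "x \<in> centralizer_modulo G Z (carrier G)"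
    using xG commutator_swap[OF Z(1) _ xG] by (auto simp: centralizer_modulo_def)
  then show ?thesis
    using x(2) by blast
qed

section \<open>The lower central series and nilpotency\<close>

lemma lower_central_series_funpow:
  "lower_central_series G n = ((\<lambda>H. commutator_subgroup G H (carrier G)) ^^ n) (carrier G)"
  by (induction n) auto

lemma one_in_lower_central_series:
  "group G \<Longrightarrow> \<one>\<^bsub>G\<^esub> \<in> lower_central_series G n"
  by (cases n) (auto simp: commutator_subgroup_def generate.one group.is_monoid monoid.one_closed)

text \<open>A maximal element of \<open>S\<close> replaces the explicit upper central series: below
  \<open>G\<close>, the preimage of the center of \<open>G / Z\<close> would be a larger member of
  \<open>S\<close>.\<close>

lemma (in group) maximal_normal_imp_nilpotent:
  assumes fin: "finite (carrier G)"
    and max_normal: "\<And>M. maximal_subgroup M G \<Longrightarrow> M \<lhd> G"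
  shows "nilpotent_group G"
proof -
  define c where "c = (\<lambda>H. commutator_subgroup G H (carrier G))"
  \<comment> \<open>\<open>S\<close> collects the normal subgroups from which repeated commutation
    with \<open>G\<close> reaches the trivial group; \<open>{\<one>}\<close> belongs to it with
    \<open>n = 0\<close>.\<close>
  define S where "S = {Z. Z \<lhd> G \<and> (\<exists>n. (c ^^ n) Z \<subseteq> {\<one>})}"
  have "mono c"
    by (auto simp: c_def mono_def dest: commutator_subgroup_mono)
  have "S \<subseteq> Pow (carrier G)"
    by (auto simp: S_def dest: normal_imp_subgroup[THEN subgroup.subset, THEN subsetD])
  then have "finite S"
    using fin finite_subset by blast
  moreover have "{\<one>} \<in> S"
    using one_is_normal by (auto simp: S_def intro: exI[of _ 0])
  ultimately obtain Z where Z: "Z \<in> S" and max: "\<And>Y. Y \<in> S \<Longrightarrow> Z \<subseteq> Y \<Longrightarrow> Z = Y"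
    using finite_has_maximal2[of S "{\<one>}"] by metis
  then obtain n where n: "(c ^^ n) Z \<subseteq> {\<one>}" and Zn: "Z \<lhd> G"
    by (auto simp: S_def)
  have "Z = carrier G"
  proof (rule ccontr)
    assume ne: "Z \<noteq> carrier G"
    let ?Y = "centralizer_modulo G Z (carrier G)"
    have "c ?Y \<subseteq> Z"
      unfolding c_def using Zn by (rule commutator_subgroup_le) simp
    \<comment> \<open>One application of \<open>c\<close> takes \<open>?Y\<close> into
      \<open>Z\<close>, so by monotonicity \<open>Suc n\<close> applications suffice for
      \<open>?Y\<close>.\<close>
    then have "(c ^^ n) (c ?Y) \<subseteq> (c ^^ n) Z"
      using \<open>mono c\<close> by (metis funpow_mono)
    then have "(c ^^ Suc n) ?Y \<subseteq> {\<one>}"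
      using n by (simp add: funpow_swap1)
    then have "?Y \<in> S"
      using centralizer_modulo_carrier_normal[OF Zn] by (auto simp: S_def simp del: funpow.simps)
    then have "Z = ?Y"
      using max normal_subset_centralizer_modulo[OF Zn] by blast
    then show False
      using ex_central_modulo[OF fin max_normal Zn ne] by blast
  qed
  then have "lower_central_series G n \<subseteq> {\<one>}"
    using n by (simp add: lower_central_series_funpow c_def)
  then have "lower_central_series G n = {\<one>}"
    using one_in_lower_central_series[OF group_axioms] by blast
  then show ?thesis
    using group_axioms by (auto simp: nilpotent_group_def)
qed

subsection \<open>The Frattini subgroup and the IC\<Phi> condition\<close>

text \<open>A maximal subgroup above a proper \<open>K\<close> also contains \<open>T\<close>, hence
  all of \<open>T <#> K\<close>.\<close>

lemma (in group) frattini_nongenerators: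
  assumes "finite (carrier G)" and K: "subgroup K G"
    and T: "T \<subseteq> frattini G" and TK: "carrier G \<subseteq> T <#> K"
  shows "K = carrier G"
proof (rule ccontr)
  assume "K \<noteq> carrier G"
  then obtain M where M: "maximal_subgroup M G" and "K \<subseteq> M"
    using ex_maximal_subgroup_above assms(1) K by blast
  moreover have "T \<subseteq> M"
    using T M by (auto simp: frattini_def)
  moreover have "subgroup M G"
    using M by (simp add: maximal_subgroup_def)
  ultimately have "T <#> K \<subseteq> M"
    using \<open>K \<subseteq> M\<close> by (auto simp: set_mult_def intro!: subgroup.m_closed)
  then show False
    using TK M subgroup.subset[OF \<open>subgroup M G\<close>] by (auto simp: maximal_subgroup_def)
qed

lemma (in group) subgroup_subset_set_mult:
  assumes "subgroup H G" and "subgroup K G"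
  shows "H \<subseteq> H <#> K" and "K \<subseteq> H <#> K"
proof -
  have "h \<otimes> \<one> \<in> H <#> K" if "h \<in> H" for h
    using that subgroup.one_closed[OF assms(2)] unfolding set_mult_def by blast
  then show "H \<subseteq> H <#> K"
    using subgroup.mem_carrier[OF assms(1)] by auto
  have "\<one> \<otimes> k \<in> H <#> K" if "k \<in> K" for k
    using that subgroup.one_closed[OF assms(1)] unfolding set_mult_def by blast
  then show "K \<subseteq> H <#> K"
    using subgroup.mem_carrier[OF assms(2)] by auto
qed

text \<open>Since \<open>K\<close> is a maximal proper normal subgroup, the normal subgroup
  \<open>?N <#> K\<close> can only be \<open>carrier G\<close> or \<open>K\<close>; each case makes
  \<open>M\<close> normal.\<close>

lemma (in group) normal_maximal_subgroup_exists:
  assumes fin: "finite (carrier G)" and nontriv: "carrier G \<noteq> {\<one>}"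
    and IC: "\<And>M. maximal_subgroup M G \<Longrightarrow> IC\<Phi>_subgroup M G"
  shows "\<exists>M. maximal_subgroup M G \<and> M \<lhd> G"
proof -
  define S where "S = {K. K \<lhd> G \<and> K \<noteq> carrier G}"
  have "S \<subseteq> Pow (carrier G)"
    by (auto simp: S_def dest: normal_imp_subgroup[THEN subgroup.subset, THEN subsetD])
  then have "finite S"
    using fin finite_subset by blast
  moreover have "{\<one>} \<in> S"
    using one_is_normal nontriv by (auto simp: S_def)
  ultimately obtain K where "K \<in> S" and max: "\<And>Y. Y \<in> S \<Longrightarrow> K \<subseteq> Y \<Longrightarrow> K = Y"
    using finite_has_maximal2[of S "{\<one>}"] by metis
  then have K: "K \<lhd> G" "K \<noteq> carrier G"
    by (simp_all add: S_def)
  interpret K: normal K G by (rule K)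
  obtain M where M: "maximal_subgroup M G" and KM: "K \<subseteq> M"
    using ex_maximal_subgroup_above[OF fin K.subgroup_axioms K(2)] .
  interpret M: subgroup M G
    using M by (simp add: maximal_subgroup_def)
  interpret GM: group "G\<lparr>carrier := M\<rparr>"
    using M.subgroup_axioms by (rule subgroup_imp_group)
  let ?N = "commutator_subgroup G M (carrier G)"
  have N: "?N \<lhd> G"
    using M.subset by (rule commutator_subgroup_normal)
  interpret N: normal ?N G by (rule N)
  have NK: "?N <#> K \<lhd> G"
    using N K(1) by (rule normal_subgroup_set_mult_closed)
  have "?N \<subseteq> ?N <#> K" "K \<subseteq> ?N <#> K"
    using subgroup_subset_set_mult[OF N.subgroup_axioms K.subgroup_axioms] .
  have "M \<lhd> G"
  proof (cases "?N <#> K = carrier G")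
    case True
    have "K = carrier (G\<lparr>carrier := M\<rparr>)"
    proof (rule GM.frattini_nongenerators)
      show "finite (carrier (G\<lparr>carrier := M\<rparr>))"
        using fin M.subset finite_subset by auto
      show "subgroup K (G\<lparr>carrier := M\<rparr>)"
        using K.subgroup_axioms M.subgroup_axioms KM by (rule subgroup_incl)
      show "M \<inter> ?N \<subseteq> frattini (G\<lparr>carrier := M\<rparr>)"
        using IC[OF M] by (simp add: IC\<Phi>_subgroup_def)
      \<comment> \<open>Dedekind's law: in \<open>m = n \<otimes> k\<close> the factor
        \<open>k\<close> lies in \<open>K \<subseteq> M\<close>, so \<open>n\<close> lies in
        \<open>M\<close> too.\<close>
      show "carrier (G\<lparr>carrier := M\<rparr>) \<subseteq> (M \<inter> ?N) <#>\<^bsub>G\<lparr>carrier := M\<rparr>\<^esub> K"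
      proof
        fix m assume "m \<in> carrier (G\<lparr>carrier := M\<rparr>)"
        then have m: "m \<in> M" by simp
        then have "m \<in> ?N <#> K"
          using True by simp
        then obtain n k where nk: "n \<in> ?N" "k \<in> K" "m = n \<otimes> k"
          by (auto simp: set_mult_def)
        have "m \<otimes> inv k \<in> M"
          using m nk(2) KM by (intro M.m_closed M.m_inv_closed) auto
        then have "n \<in> M"
          using nk by (simp add: m_assoc)
        then show "m \<in> (M \<inter> ?N) <#>\<^bsub>G\<lparr>carrier := M\<rparr>\<^esub> K"
          using nk by (auto simp: set_mult_def)
      qed
    qed
    then show ?thesis
      using K(1) by simp
  next
    case False
    then have "K = ?N <#> K"
      using max NK \<open>K \<subseteq> ?N <#> K\<close> by (simp add: S_def)
    then have NM: "?N \<subseteq> M"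
      using \<open>?N \<subseteq> ?N <#> K\<close> KM by blast
    show ?thesis
    proof (rule normal_invI[OF M.subgroup_axioms])
      fix g m assume g: "g \<in> carrier G" and m: "m \<in> M"
      \<comment> \<open>The conjugate of \<open>m\<close> by \<open>g\<close> is
        \<open>[g, m] m\<close>, with \<open>[g, m]\<close> in
        \<open>?N \<subseteq> M\<close>.\<close>
      have "g \<otimes> m \<otimes> inv g \<otimes> inv m \<in> ?N"
        by (rule commutator_swap[OF N M.mem_carrier[OF m] g commutator_subgroup_incl[OF m g]])
      then have "g \<otimes> m \<otimes> inv g \<otimes> inv m \<otimes> m \<in> M"
        using NM by (intro M.m_closed[OF _ m]) (rule subsetD)
      then show "g \<otimes> m \<otimes> inv g \<in> M"
        using g m by (simp add: m_assoc)
    qed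
  qed
  then show ?thesis
    using M by blast
qed

text \<open>A single normal maximal \<open>M\<close> controls every \<open>L\<close>: all
  commutators of \<open>G\<close> lie in \<open>?T\<close>, and \<open>?T\<close> lies in
  \<open>L\<close>.\<close>

lemma (in group) maximal_subgroups_normal:
  assumes fin: "finite (carrier G)"
    and M: "maximal_subgroup M G" "M \<lhd> G" "IC\<Phi>_subgroup M G" and L: "maximal_subgroup L G"
  shows "L \<lhd> G"
proof -
  interpret M: normal M G by (rule M)
  interpret L: subgroup L G
    using L by (simp add: maximal_subgroup_def)
  interpret GM: group "G\<lparr>carrier := M\<rparr>"
    using M.subgroup_axioms by (rule subgroup_imp_group)
  let ?T = "commutator_subgroup G M (carrier G)"
  have T: "?T \<lhd> G"
    using M.subset by (rule commutator_subgroup_normal)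
  interpret T: normal ?T G by (rule T)
  \<comment> \<open>Normality of \<open>M\<close> gives \<open>M \<inter> ?T = ?T\<close>, so the
    IC\<Phi> condition bounds all of \<open>?T\<close>.\<close>
  have "?T \<subseteq> M"
    using M(2) normal_subset_centralizer_modulo[OF M(2)] by (intro commutator_subgroup_le) auto
  then have T_frattini: "?T \<subseteq> frattini (G\<lparr>carrier := M\<rparr>)"
    using M(3) by (auto simp: IC\<Phi>_subgroup_def)
  \<comment> \<open>\<open>G\<close> is generated by \<open>M\<close> and any element outside \<open>M\<close>; applied twice, this makes \<open>G / ?T\<close> abelian.\<close>
  have generated: "C = carrier G" if "subgroup C G" "M \<subseteq> C" "x \<in> C" "x \<notin> M" for C x
    using that M(1) by (auto simp: maximal_subgroup_def)
  obtain x where x: "x \<in> carrier G" "x \<notin> M"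
    using M(1) M.subset by (auto simp: maximal_subgroup_def)
  have M_central: "M \<subseteq> centralizer_modulo G ?T (carrier G)"
    by (auto simp: centralizer_modulo_def commutator_subgroup_incl)
  \<comment> \<open>\<open>M\<close> is central modulo \<open>?T\<close> by the choice of
    \<open>?T\<close>, and \<open>x\<close> commutes with itself.\<close>
  have "centralizer_modulo G ?T {x} = carrier G"
  proof (rule generated)
    show "subgroup (centralizer_modulo G ?T {x}) G"
      using T x by (intro centralizer_modulo_subgroup) auto
    show "M \<subseteq> centralizer_modulo G ?T {x}"
      using M_central x by (auto simp: centralizer_modulo_def)
    show "x \<in> centralizer_modulo G ?T {x}"
      using x by (simp add: centralizer_modulo_def m_assoc)
  qed (rule x)
  then have "x \<in> centralizer_modulo G ?T (carrier G)"
    using x commutator_swap[OF T _ x(1)] by (auto simp: centralizer_modulo_def)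
  then have "centralizer_modulo G ?T (carrier G) = carrier G"
    using centralizer_modulo_subgroup[OF T subset_refl] M_central x by (intro generated)
  then have comm: "g \<otimes> h \<otimes> inv g \<otimes> inv h \<in> ?T" if "g \<in> carrier G" "h \<in> carrier G" for g h
    using that by (auto simp: centralizer_modulo_def)
  have "?T \<subseteq> L"
  proof (rule ccontr)
    assume "\<not> ?T \<subseteq> L"
    have "?T \<subseteq> ?T <#> L" "L \<subseteq> ?T <#> L"
      using subgroup_subset_set_mult[OF T.subgroup_axioms L.subgroup_axioms] .
    \<comment> \<open>The product is a subgroup properly containing the maximal subgroup
      \<open>L\<close>.\<close>
    then have TL: "?T <#> L = carrier G"
      using L mult_norm_subgroup[OF T L.subgroup_axioms] \<open>\<not> ?T \<subseteq> L\<close>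
      by (metis maximal_subgroup_def)
    have "L \<inter> M = carrier (G\<lparr>carrier := M\<rparr>)"
    proof (rule GM.frattini_nongenerators[OF _ _ T_frattini])
      show "finite (carrier (G\<lparr>carrier := M\<rparr>))"
        using fin M.subset finite_subset by auto
      show "subgroup (L \<inter> M) (G\<lparr>carrier := M\<rparr>)"
        using L.subgroup_axioms M.subgroup_axioms by (intro subgroup_incl subgroups_Inter_pair) auto
      show "carrier (G\<lparr>carrier := M\<rparr>) \<subseteq> ?T <#>\<^bsub>G\<lparr>carrier := M\<rparr>\<^esub> (L \<inter> M)"
      proof
        fix m assume "m \<in> carrier (G\<lparr>carrier := M\<rparr>)"
        then have m: "m \<in> M" by simp
        then have "m \<in> ?T <#> L"
          using TL by simp
        then obtain t l where tl: "t \<in> ?T" "l \<in> L" "m = t \<otimes> l"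
          by (auto simp: set_mult_def)
        have "inv t \<otimes> m \<in> M"
          using m tl(1) \<open>?T \<subseteq> M\<close> by (intro M.m_closed M.m_inv_closed) auto
        then have "l \<in> M"
          using tl by (simp add: inv_mult_cancel)
        then show "m \<in> ?T <#>\<^bsub>G\<lparr>carrier := M\<rparr>\<^esub> (L \<inter> M)"
          using tl by (auto simp: set_mult_def)
      qed
    qed
    then show False
      using \<open>?T \<subseteq> M\<close> \<open>\<not> ?T \<subseteq> L\<close> by auto
  qed
  show ?thesis
  proof (rule normal_invI[OF L.subgroup_axioms])
    fix g l assume g: "g \<in> carrier G" and l: "l \<in> L"
    have "g \<otimes> l \<otimes> inv g \<otimes> inv l \<otimes> l \<in> L"
      by (rule L.m_closed[OF subsetD[OF \<open>?T \<subseteq> L\<close> comm[OF g L.mem_carrier[OF l]]] l])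
    then show "g \<otimes> l \<otimes> inv g \<in> L"
      using g l by (simp add: m_assoc)
  qed
qed

theorem theorem1p7:
  fixes G :: "('a, 'b) monoid_scheme" (structure)
  assumes "group G" and "finite (carrier G)"
    and "\<And>M. maximal_subgroup M G \<Longrightarrow> IC\<Phi>_subgroup M G"
  shows "nilpotent_group G"
proof -
  interpret group G by fact
  show ?thesis
  \<comment> \<open>The trivial group has no maximal subgroup to start from, but its series is
    trivial already at index 0.\<close>
  proof (cases "carrier G = {\<one>}")
    case True
    then have "lower_central_series G 0 = {\<one>}" by simp
    then show ?thesis
      using assms(1) unfolding nilpotent_group_def by blast
  next
    case False
    then obtain M where "maximal_subgroup M G" "M \<lhd> G"
      using normal_maximal_subgroup_exists[OF assms(2) _ assms(3)] by blast
    then show ?thesis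
      using maximal_subgroups_normal[OF assms(2)] assms(3) maximal_normal_imp_nilpotent[OF assms(2)]
      by blast
  qed
qed

end
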